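(* Let $F$ be a field. For every non-empty finite subset $B$ of $\mathbb N$ let $E_B\in F\Pi_B$ be a $\Delta$-primitive idempotent, and set $E_Q=E_{Q_1}\vee\cdots\vee E_{Q_k}$ for all $Q=(Q_1,\ldots,Q_k)\in\Pi$. Then, for every finite subset $A$ of $\mathbb N$, $\{E_Q\mid Q\in\Pi_A\}$ is a linear basis of $F\Pi_A$.
   Context: For a finite subset $A$ of $\mathbb N=\{1,2,\ldots\}$, a set composition of $A$ is a tuple $P=(P_1,\ldots,P_l)$ of mutually disjoint non-empty subsets of $A$ with union $A$; $\Pi_A$ is the set of all set compositions of $A$. $\Pi_\emptyset$ consists of the empty tuple, denoted $\emptyset$ (and $E_\emptyset=\emptyset$, the empty product, for the empty tuple). $\Pi=\bigcup_A\Pi_A$; $F\Pi_A$ is the $F$-vector space with basis $\Pi_A$ and $F\Pi=\bigoplus_AF\Pi_A$, over all finite $A\subset\mathbb N$. Bilinear products on $F\Pi$: for $P=(P_1,\ldots,P_l)\in\Pi_A$, $Q=(Q_1,\ldots,Q_k)\in\Pi_B$, $P\wedge Q=(P_1\cap Q_1,\ldots,P_1\cap Q_k,\ldots,P_l\cap Q_1,\ldots,P_l\cap Q_k)$ with empty sets deleted if $A=B$, and $0$ if $A\neq B$; $P\vee Q=(P_1,\ldots,P_l,Q_1,\ldots,Q_k)$ if $A\cap B=\emptyset$, and $0$ otherwise. Coproduct: the linear map $\Delta:F\Pi\to F\Pi\otimes F\Pi$ with $\Delta(P)=\sum_{X\subseteq A}P|_X\otimes P|_{A\setminus X}$ for $P\in\Pi_A$,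 where $P|_X$ is $(P_1\cap X,\ldots,P_l\cap X)$ with empty sets deleted. A $\Delta$-primitive idempotent in $F\Pi_B$ is a non-zero $E\in F\Pi_B$ with $\Delta(E)=E\otimes\emptyset+\emptyset\otimes E$ and $E\wedge E=E$. *)

theory Defs
  imports Complex_Main "HOL-Library.Poly_Mapping"
begin

text \<open>
  A tuple of subsets of \<open>{1, 2, \<dots>}\<close> is a list of type \<^typ>\<open>nat set list\<close>, and a formal linear
  combination of tuples is a finitely supported function \<^typ>\<open>nat set list \<Rightarrow>\<^sub>0 'f\<close>. The space
  spanned by all set compositions is the subspace of those with support in \<open>set_comps A\<close>,
  for varying \<open>A\<close>, cut out by \<open>FPi\<close> below. The operations are defined on all of
  \<^typ>\<open>nat set list \<Rightarrow>\<^sub>0 'f\<close>; their values on tuples that are not set compositions are immaterial.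
\<close>

definition set_comps :: "nat set \<Rightarrow> nat set list set" where
  "set_comps A =
     {P. (\<forall>i<length P. \<forall>j<length P. i \<noteq> j \<longrightarrow> P ! i \<inter> P ! j = {}) \<and> {} \<notin> set P \<and> \<Union>(set P) = A}"

definition FPi :: "nat set \<Rightarrow> (nat set list \<Rightarrow>\<^sub>0 'f::field) set" where
  "FPi A = {f. Poly_Mapping.keys f \<subseteq> set_comps A}"

definition smul :: "'f::field \<Rightarrow> ('k \<Rightarrow>\<^sub>0 'f) \<Rightarrow> ('k \<Rightarrow>\<^sub>0 'f)" where
  "smul c f = Poly_Mapping.map ((*) c) f"

lemma lookup_smul: "Poly_Mapping.lookup (smul c f) k = c * Poly_Mapping.lookup f k"
  by (simp add: smul_def Poly_Mapping.map.rep_eq when_def)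

interpretation FPi: vector_space "smul :: 'f::field \<Rightarrow> ('k \<Rightarrow>\<^sub>0 'f) \<Rightarrow> ('k \<Rightarrow>\<^sub>0 'f)"
  by unfold_locales
    (auto intro!: poly_mapping_eqI simp: lookup_smul Poly_Mapping.lookup_add algebra_simps)

definition lin_ext :: "('k \<Rightarrow> ('l \<Rightarrow>\<^sub>0 'f::field)) \<Rightarrow> ('k \<Rightarrow>\<^sub>0 'f) \<Rightarrow> ('l \<Rightarrow>\<^sub>0 'f)" where
  "lin_ext h f = (\<Sum>k\<in>Poly_Mapping.keys f. smul (Poly_Mapping.lookup f k) (h k))"

definition bilin_ext ::
  "('k \<Rightarrow> 'l \<Rightarrow> ('m \<Rightarrow>\<^sub>0 'f::field)) \<Rightarrow> ('k \<Rightarrow>\<^sub>0 'f) \<Rightarrow> ('l \<Rightarrow>\<^sub>0 'f) \<Rightarrow> ('m \<Rightarrow>\<^sub>0 'f)" where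
  "bilin_ext h f g = lin_ext (\<lambda>k. lin_ext (\<lambda>l. h k l) g) f"

text \<open>The set composed by \<open>P\<close> is recovered as \<open>\<Union>(set P)\<close>.\<close>

definition wedge ::
  "(nat set list \<Rightarrow>\<^sub>0 'f::field) \<Rightarrow> (nat set list \<Rightarrow>\<^sub>0 'f) \<Rightarrow> (nat set list \<Rightarrow>\<^sub>0 'f)"
  (infixl \<open>\<^bold>\<and>\<close> 70) where
  "f \<^bold>\<and> g = bilin_ext
     (\<lambda>P Q. if \<Union>(set P) = \<Union>(set Q)
            then Poly_Mapping.single (filter (\<lambda>S. S \<noteq> {}) [p \<inter> q. p \<leftarrow> P, q \<leftarrow> Q]) 1
            else 0) f g"

definition vee ::
  "(nat set list \<Rightarrow>\<^sub>0 'f::field) \<Rightarrow> (nat set list \<Rightarrow>\<^sub>0 'f) \<Rightarrow> (nat set list \<Rightarrow>\<^sub>0 'f)"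
  (infixr \<open>\<^bold>\<or>\<close> 65) where
  "f \<^bold>\<or> g = bilin_ext
     (\<lambda>P Q. if \<Union>(set P) \<inter> \<Union>(set Q) = {} then Poly_Mapping.single (P @ Q) 1 else 0) f g"

definition restr :: "nat set list \<Rightarrow> nat set \<Rightarrow> nat set list" where
  "restr P X = filter (\<lambda>S. S \<noteq> {}) (map (\<lambda>p. p \<inter> X) P)"

text \<open>
  The tensor square of the free vector space on tuples is realised as the free vector space on
  pairs of tuples, the pair \<open>(P, Q)\<close> standing for the basis vector \<open>P \<otimes> Q\<close>.
\<close>

definition tensor ::
  "('k \<Rightarrow>\<^sub>0 'f::field) \<Rightarrow> ('l \<Rightarrow>\<^sub>0 'f) \<Rightarrow> ('k \<times> 'l \<Rightarrow>\<^sub>0 'f)" (infixr \<open>\<^bold>\<otimes>\<close> 75) where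
  "f \<^bold>\<otimes> g = bilin_ext (\<lambda>k l. Poly_Mapping.single (k, l) 1) f g"

definition coprod ::
  "(nat set list \<Rightarrow>\<^sub>0 'f::field) \<Rightarrow> (nat set list \<times> nat set list \<Rightarrow>\<^sub>0 'f)" where
  "coprod = lin_ext
     (\<lambda>P. \<Sum>X\<in>Pow (\<Union>(set P)).
        Poly_Mapping.single (restr P X) 1 \<^bold>\<otimes> Poly_Mapping.single (restr P (\<Union>(set P) - X)) 1)"

definition empty_comp :: "nat set list \<Rightarrow>\<^sub>0 'f::field" where
  "empty_comp = Poly_Mapping.single [] 1"

definition primitive_idempotent :: "nat set \<Rightarrow> (nat set list \<Rightarrow>\<^sub>0 'f::field) \<Rightarrow> bool" where
  "primitive_idempotent B E \<longleftrightarrow>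
     E \<in> FPi B \<and> E \<noteq> 0 \<and> coprod E = E \<^bold>\<otimes> empty_comp + empty_comp \<^bold>\<otimes> E \<and> E \<^bold>\<and> E = E"

text \<open>
  \<open>E\<^bsub>Q\<^esub> = E\<^bsub>Q\<^sub>1\<^esub> \<or> \<dots> \<or> E\<^bsub>Q\<^sub>k\<^esub>\<close>, starting from the neutral element \<open>empty_comp\<close> of \<open>\<or>\<close>.
\<close>

definition E_comp :: "(nat set \<Rightarrow> (nat set list \<Rightarrow>\<^sub>0 'f::field)) \<Rightarrow> nat set list \<Rightarrow> (nat set list \<Rightarrow>\<^sub>0 'f)"
  where "E_comp E Q = foldr (\<lambda>S f. E S \<^bold>\<or> f) Q empty_comp"

end

theory Submission
  imports Defs
begin

text \<open>
  Order the set compositions of \<open>A\<close> by their number of blocks. The family \<open>E\<^bsub>Q\<^esub>\<close> is unitriangular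
  for this order: \<open>E\<^bsub>Q\<^esub>\<close> is \<open>Q\<close> plus a combination of compositions with strictly more blocks than
  \<open>Q\<close>. Hence, by downward induction on the number of blocks, the \<open>E\<^bsub>Q\<^esub>\<close> span all of \<open>F\<Pi>\<^sub>A\<close>, and as
  there are no more of them than elements of the standard basis, they are linearly independent.

  Since \<open>\<or>\<close> concatenates tuples, unitriangularity is inherited by \<open>\<or>\<close>-products
  (\<open>leads_vee\<close>), so everything rests on the case of a single block: the coefficient of \<open>(B)\<close> in
  a \<open>\<Delta>\<close>-primitive idempotent \<open>E\<close> of \<open>F\<Pi>\<^sub>B\<close> is \<open>1\<close>. To see this, write
  \<open>P \<and> Q = Q|\<^bsub>P\<^sub>1\<^esub> \<or> \<dots> \<or> Q|\<^bsub>P\<^sub>l\<^esub>\<close>. If \<open>P\<close> has at least two blocks, then \<open>P \<and> E\<close> depends only on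
  the component of \<open>\<Delta>(E)\<close> in \<open>F\<Pi>\<^bsub>P\<^sub>1\<^esub> \<otimes> F\<Pi>\<^bsub>B - P\<^sub>1\<^esub>\<close>, and this component is zero because \<open>E\<close> is
  primitive and \<open>P\<^sub>1\<close> is neither empty nor \<open>B\<close> (\<open>wedge_primitive_eq_0\<close>). The only
  composition with a single block, \<open>(B)\<close>, is a left identity. Thus \<open>E = E \<and> E = c E\<close>, where
  \<open>c\<close> is the coefficient of \<open>(B)\<close> in \<open>E\<close>, and \<open>E \<noteq> 0\<close> forces \<open>c = 1\<close>
  (\<open>lookup_primitive_idempotent\<close>).
\<close>

section \<open>Linear extension\<close>

lemma lin_ext_eq_sum:
  assumes "finite K" "Poly_Mapping.keys f \<subseteq> K"
  shows "lin_ext h f = (\<Sum>k\<in>K. smul (Poly_Mapping.lookup f k) (h k))"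
  unfolding lin_ext_def
  by (rule sum.mono_neutral_left) (use assms in \<open>auto simp: in_keys_iff\<close>)

lemma lin_ext_add: "lin_ext h (f + g) = lin_ext h f + lin_ext h g"
proof -
  let ?K = "Poly_Mapping.keys f \<union> Poly_Mapping.keys g"
  have "Poly_Mapping.keys (f + g) \<subseteq> ?K"
    by (rule Poly_Mapping.keys_add)
  then show ?thesis
    by (simp add: lin_ext_eq_sum[of ?K] Poly_Mapping.lookup_add FPi.scale_left_distrib
        sum.distrib)
qed

lemma keys_smul: "Poly_Mapping.keys (smul c f) \<subseteq> Poly_Mapping.keys f"
  by (auto simp: in_keys_iff lookup_smul)

lemma lin_ext_smul: "lin_ext h (smul c f) = smul c (lin_ext h f)"
  using keys_smul[of c f]
  by (simp add: lin_ext_eq_sum[of "Poly_Mapping.keys f"] lookup_smul FPi.scale_sum_right)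

lemma lin_ext_0 [simp]: "lin_ext h 0 = 0"
  by (simp add: lin_ext_def)

lemma lin_ext_sum: "lin_ext h (sum f I) = (\<Sum>i\<in>I. lin_ext h (f i))"
  by (induction I rule: infinite_finite_induct) (auto simp: lin_ext_add)

lemma lin_ext_single [simp]: "lin_ext h (Poly_Mapping.single k 1) = h k"
  by (simp add: lin_ext_def)

lemma lin_ext_lin_ext: "lin_ext g (lin_ext h f) = lin_ext (\<lambda>k. lin_ext g (h k)) f"
  by (simp add: lin_ext_def[of h] lin_ext_def[of _ f] lin_ext_sum lin_ext_smul)

lemma lin_ext_cong:
  "(\<And>k. k \<in> Poly_Mapping.keys f \<Longrightarrow> h k = h' k) \<Longrightarrow> lin_ext h f = lin_ext h' f"
  by (simp add: lin_ext_def)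

lemma lin_ext_eq_0: "(\<And>k. k \<in> Poly_Mapping.keys f \<Longrightarrow> h k = 0) \<Longrightarrow> lin_ext h f = 0"
  by (simp add: lin_ext_def)

lemma lin_ext_singles: "lin_ext (\<lambda>k. Poly_Mapping.single k 1) f = f"
  by (rule poly_mapping_eqI)
    (simp add: lin_ext_def lookup_sum lookup_smul Poly_Mapping.lookup_single when_def
      if_distrib[of "(*) _"] in_keys_iff cong: if_cong)

lemma keys_lin_ext:
  "Poly_Mapping.keys (lin_ext h f) \<subseteq> (\<Union>k\<in>Poly_Mapping.keys f. Poly_Mapping.keys (h k))"
proof -
  have "Poly_Mapping.keys (lin_ext h f) \<subseteq>
      (\<Union>k\<in>Poly_Mapping.keys f. Poly_Mapping.keys (smul (Poly_Mapping.lookup f k) (h k)))"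
    unfolding lin_ext_def by (rule keys_sum)
  also have "\<dots> \<subseteq> (\<Union>k\<in>Poly_Mapping.keys f. Poly_Mapping.keys (h k))"
    using keys_smul by fast
  finally show ?thesis .
qed

lemma lin_ext_in_span:
  assumes "\<And>k. k \<in> Poly_Mapping.keys f \<Longrightarrow> h k \<in> FPi.span S"
  shows "lin_ext h f \<in> FPi.span S"
  unfolding lin_ext_def by (intro FPi.span_sum FPi.span_scale assms)

section \<open>Set compositions\<close>

lemma Nil_in_set_comps_iff [simp]: "[] \<in> set_comps A \<longleftrightarrow> A = {}"
  by (auto simp: set_comps_def)

lemma disjoint_nth_Cons_iff:
  "(\<forall>i<length (S # P). \<forall>j<length (S # P). i \<noteq> j \<longrightarrow> (S # P) ! i \<inter> (S # P) ! j = {}) \<longleftrightarrow>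
   S \<inter> \<Union>(set P) = {} \<and> (\<forall>i<length P. \<forall>j<length P. i \<noteq> j \<longrightarrow> P ! i \<inter> P ! j = {})"
proof -
  have "S \<inter> \<Union>(set P) = {} \<longleftrightarrow> (\<forall>i<length P. S \<inter> P ! i = {})"
    by (fastforce simp: in_set_conv_nth disjoint_iff)
  then show ?thesis
    by (simp add: All_less_Suc2 Int_commute) blast
qed

lemma Cons_in_set_comps_iff:
  "S # P \<in> set_comps A \<longleftrightarrow> S \<noteq> {} \<and> S \<subseteq> A \<and> P \<in> set_comps (A - S)"
  unfolding set_comps_def mem_Collect_eq disjoint_nth_Cons_iff by auto

lemma append_in_set_comps:
  "P \<in> set_comps A \<Longrightarrow> Q \<in> set_comps B \<Longrightarrow> A \<inter> B = {} \<Longrightarrow> P @ Q \<in> set_comps (A \<union> B)"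
proof (induction P arbitrary: A)
  case (Cons S P)
  then have "P @ Q \<in> set_comps ((A - S) \<union> B)"
    by (auto simp: Cons_in_set_comps_iff)
  moreover have "(A - S) \<union> B = (A \<union> B) - S"
    using Cons.prems by (auto simp: Cons_in_set_comps_iff)
  ultimately show ?case
    using Cons.prems by (auto simp: Cons_in_set_comps_iff)
qed simp

lemma Union_set_comps: "P \<in> set_comps A \<Longrightarrow> \<Union>(set P) = A"
  by (simp add: set_comps_def)

lemma distinct_set_comps: "P \<in> set_comps A \<Longrightarrow> distinct P"
proof (induction P arbitrary: A)
  case (Cons S P)
  then show ?case
    using Union_set_comps[of P "A - S"] by (auto simp: Cons_in_set_comps_iff)
qed simp

lemma finite_set_comps: "finite A \<Longrightarrow> finite (set_comps A)"
  by (rule finite_subset[OF _ finite_subset_distinct[of "Pow A"]])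
    (auto simp: distinct_set_comps dest: Union_set_comps)

section \<open>Primitive idempotents\<close>

text \<open>
  This is \<open>(S, P\<^sub>2, \<dots>, P\<^sub>l) \<and> Q = Q|\<^bsub>S\<^esub> \<or> ((P\<^sub>2, \<dots>, P\<^sub>l) \<and> Q|\<^bsub>B - S\<^esub>)\<close>, which exhibits the left
  multiplication by a composition as a function of the coproduct.
\<close>

lemma wedge_tuple_Cons:
  assumes "\<Union>(set P) \<subseteq> B - S"
  shows "filter (\<lambda>S. S \<noteq> {}) [p \<inter> q. p \<leftarrow> S # P, q \<leftarrow> Q] =
    restr Q S @ filter (\<lambda>S. S \<noteq> {}) [p \<inter> q. p \<leftarrow> P, q \<leftarrow> restr Q (B - S)]"
proof -
  have "filter (\<lambda>S. S \<noteq> {}) (map ((\<inter>) p) Q) =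
      filter (\<lambda>S. S \<noteq> {}) (map ((\<inter>) p) (restr Q (B - S)))" if "p \<subseteq> B - S" for p
  proof (induction Q)
    case (Cons q Q)
    have "p \<inter> (q \<inter> (B - S)) = p \<inter> q"
      using that by auto
    then show ?case
      using Cons by (auto simp: restr_def)
  qed (simp add: restr_def)
  then have "filter (\<lambda>S. S \<noteq> {}) [p \<inter> q. p \<leftarrow> P, q \<leftarrow> Q] =
      filter (\<lambda>S. S \<noteq> {}) [p \<inter> q. p \<leftarrow> P, q \<leftarrow> restr Q (B - S)]"
    using assms by (induction P) auto
  moreover have "(\<lambda>q. q \<inter> S) = (\<inter>) S"
    by auto
  ultimately show ?thesis
    by (simp add: restr_def)
qed

lemma Union_restr: "\<Union>(set (restr Q X)) = \<Union>(set Q) \<inter> X"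
  by (auto simp: restr_def)

lemma tensor_singles:
  "Poly_Mapping.single k 1 \<^bold>\<otimes> Poly_Mapping.single l 1 = Poly_Mapping.single (k, l) 1"
  by (simp add: tensor_def bilin_ext_def)

lemma lin_ext_coprod_single:
  "lin_ext h (coprod (Poly_Mapping.single Q 1)) =
    (\<Sum>X\<in>Pow (\<Union>(set Q)). h (restr Q X, restr Q (\<Union>(set Q) - X)))"
  by (simp add: coprod_def tensor_singles lin_ext_sum)

lemma lin_ext_coprod:
  "lin_ext h (coprod f) = lin_ext (\<lambda>Q. lin_ext h (coprod (Poly_Mapping.single Q 1))) f"
  by (simp add: coprod_def lin_ext_lin_ext)

lemma wedge_primitive_eq_0:
  fixes E :: "nat set list \<Rightarrow>\<^sub>0 'f::field"
  assumes P: "P \<in> set_comps B" "P \<noteq> [B]" and B: "finite B" "B \<noteq> {}"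
    and E: "E \<in> FPi B" "coprod E = E \<^bold>\<otimes> empty_comp + empty_comp \<^bold>\<otimes> E"
  shows "Poly_Mapping.single P 1 \<^bold>\<and> E = 0"
proof -
  obtain S P' where P_eq: "P = S # P'"
    using P B by (cases P) auto
  have S: "S \<noteq> {}" "S \<subseteq> B" and P': "P' \<in> set_comps (B - S)"
    using P by (auto simp: P_eq Cons_in_set_comps_iff)
  have "S \<noteq> B"
  proof
    assume "S = B"
    moreover from this have "P' = []"
      using P' by (cases P') (auto simp: Cons_in_set_comps_iff)
    ultimately show False
      using P P_eq by simp
  qed
  have keys_E: "Q \<in> set_comps B" if "Q \<in> Poly_Mapping.keys E" for Q
    using E that by (auto simp: FPi_def)
  \<comment> \<open>\<open>T\<close> projects to the component \<open>F\<Pi>\<^bsub>S\<^esub> \<otimes> F\<Pi>\<^bsub>B - S\<^esub>\<close> of the tensor square and sends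
    \<open>R \<otimes> R'\<close> there to \<open>R \<or> (P' \<and> R')\<close>.\<close>
  define T :: "nat set list \<times> nat set list \<Rightarrow> (nat set list \<Rightarrow>\<^sub>0 'f)" where
    "T = (\<lambda>(R, R'). if \<Union>(set R) = S
      then Poly_Mapping.single (R @ filter (\<lambda>S. S \<noteq> {}) [p \<inter> q. p \<leftarrow> P', q \<leftarrow> R']) 1 else 0)"
  define h :: "nat set list \<Rightarrow> (nat set list \<Rightarrow>\<^sub>0 'f)" where
    "h = (\<lambda>Q. if \<Union>(set P) = \<Union>(set Q)
      then Poly_Mapping.single (filter (\<lambda>S. S \<noteq> {}) [p \<inter> q. p \<leftarrow> P, q \<leftarrow> Q]) 1 else 0)"
  have T_coprod: "lin_ext T (coprod (Poly_Mapping.single Q 1)) = h Q" if "Q \<in> set_comps B" for Q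
  proof -
    have [simp]: "\<Union>(set Q) = B" "\<Union>(set P) = B"
      using that P by (simp_all add: Union_set_comps)
    have "lin_ext T (coprod (Poly_Mapping.single Q 1)) =
        (\<Sum>X\<in>Pow B. T (restr Q X, restr Q (B - X)))"
      by (simp add: lin_ext_coprod_single)
    also have "\<dots> = (\<Sum>X\<in>{S}. T (restr Q X, restr Q (B - X)))"
      by (rule sum.mono_neutral_right) (use B S in \<open>auto simp: T_def Union_restr\<close>)
    also have "\<dots> = h Q"
      using S P' wedge_tuple_Cons[of P' B S Q]
      by (simp add: T_def h_def P_eq Union_restr Union_set_comps Un_absorb1 Int_absorb1)
    finally show ?thesis .
  qed
  have "Poly_Mapping.single P 1 \<^bold>\<and> E = lin_ext h E"
    by (simp add: wedge_def bilin_ext_def h_def)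
  also have "\<dots> = lin_ext T (coprod E)"
    unfolding lin_ext_coprod[of T E] by (rule lin_ext_cong) (simp add: T_coprod keys_E)
  also have "\<dots> = lin_ext T (E \<^bold>\<otimes> empty_comp) + lin_ext T (empty_comp \<^bold>\<otimes> E)"
    by (simp add: E lin_ext_add)
  also have "lin_ext T (E \<^bold>\<otimes> empty_comp) = 0"
    unfolding tensor_def bilin_ext_def empty_comp_def lin_ext_lin_ext
    by (rule lin_ext_eq_0) (use \<open>S \<noteq> B\<close> in \<open>simp add: T_def Union_set_comps[OF keys_E]\<close>)
  also have "lin_ext T (empty_comp \<^bold>\<otimes> E) = 0"
    unfolding tensor_def bilin_ext_def empty_comp_def lin_ext_lin_ext
    by (rule lin_ext_eq_0) (use S in \<open>auto simp: T_def lin_ext_lin_ext intro!: lin_ext_eq_0\<close>)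
  finally show ?thesis
    by simp
qed

lemma single_wedge:
  assumes "E \<in> FPi B"
  shows "Poly_Mapping.single [B] 1 \<^bold>\<and> E = E"
proof -
  have "filter (\<lambda>S. S \<noteq> {}) (map ((\<inter>) B) Q) = Q" if "Q \<in> set_comps B" for Q
  proof -
    have "map ((\<inter>) B) Q = Q"
      using Union_set_comps[OF that] by (intro map_idI) auto
    moreover have "filter (\<lambda>S. S \<noteq> {}) Q = Q"
      using that by (auto simp: set_comps_def filter_id_conv)
    ultimately show ?thesis
      by simp
  qed
  moreover have "Q \<in> set_comps B" if "Q \<in> Poly_Mapping.keys E" for Q
    using assms that by (auto simp: FPi_def)
  moreover from this have "\<Union>(set Q) = B" if "Q \<in> Poly_Mapping.keys E" for Q
    using that by (simp add: Union_set_comps)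
  ultimately have "Poly_Mapping.single [B] 1 \<^bold>\<and> E = lin_ext (\<lambda>Q. Poly_Mapping.single Q 1) E"
    unfolding wedge_def bilin_ext_def lin_ext_single
    by (intro lin_ext_cong) simp
  then show ?thesis
    by (simp add: lin_ext_singles)
qed

text \<open>
  Expanding the left factor of \<open>E \<and> E\<close> kills every composition except \<open>(B)\<close>, so \<open>E\<close> equals
  its coefficient at \<open>(B)\<close> times itself.
\<close>

lemma lookup_primitive_idempotent:
  assumes "primitive_idempotent B E" and B: "finite B" "B \<noteq> {}"
  shows "Poly_Mapping.lookup E [B] = 1"
proof -
  have E: "E \<in> FPi B" "E \<noteq> 0" "coprod E = E \<^bold>\<otimes> empty_comp + empty_comp \<^bold>\<otimes> E" "E \<^bold>\<and> E = E"
    using assms by (auto simp: primitive_idempotent_def)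
  have "E = lin_ext (\<lambda>P. Poly_Mapping.single P 1 \<^bold>\<and> E) E"
    using E(4) by (simp add: wedge_def bilin_ext_def)
  also have "\<dots> = (\<Sum>P\<in>insert [B] (Poly_Mapping.keys E).
      smul (Poly_Mapping.lookup E P) (Poly_Mapping.single P 1 \<^bold>\<and> E))"
    by (rule lin_ext_eq_sum) auto
  also have "\<dots> = (\<Sum>P\<in>{[B]}. smul (Poly_Mapping.lookup E P) (Poly_Mapping.single P 1 \<^bold>\<and> E))"
  proof (rule sum.mono_neutral_right)
    show "\<forall>P\<in>insert [B] (Poly_Mapping.keys E) - {[B]}.
        smul (Poly_Mapping.lookup E P) (Poly_Mapping.single P 1 \<^bold>\<and> E) = 0"
      using wedge_primitive_eq_0[OF _ _ B E(1,3)] E(1) by (auto simp: FPi_def)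
  qed auto
  also have "\<dots> = smul (Poly_Mapping.lookup E [B]) E"
    by (simp add: single_wedge[OF E(1)])
  finally have "smul (Poly_Mapping.lookup E [B]) E = smul 1 E"
    by simp
  then show ?thesis
    using E(2) by (simp only: FPi.scale_cancel_right) simp
qed

section \<open>Unitriangularity\<close>

definition leads :: "nat set \<Rightarrow> nat set list \<Rightarrow> (nat set list \<Rightarrow>\<^sub>0 'f::field) \<Rightarrow> bool" where
  "leads A P f \<longleftrightarrow> Poly_Mapping.keys (f - Poly_Mapping.single P 1) \<subseteq>
     {Q \<in> set_comps A. length P < length Q}"

lemma leads_empty_comp: "leads {} [] empty_comp"
  by (simp add: leads_def empty_comp_def)

lemma leads_primitive_idempotent:
  assumes "primitive_idempotent B E" "finite B" "B \<noteq> {}"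
  shows "leads B [B] E"
proof -
  have "P \<in> set_comps B \<and> 1 < length P"
    if "P \<in> Poly_Mapping.keys (E - Poly_Mapping.single [B] 1)" for P
  proof -
    \<comment> \<open>The coefficient at \<open>(B)\<close> is \<open>1\<close>, so the subtraction removes this composition.\<close>
    have "P \<noteq> [B]" "P \<in> Poly_Mapping.keys E"
      using that lookup_primitive_idempotent[OF assms]
      by (auto simp: in_keys_iff Poly_Mapping.lookup_minus Poly_Mapping.lookup_single when_def
          split: if_splits)
    moreover from this have "P \<in> set_comps B"
      using assms by (auto simp: primitive_idempotent_def FPi_def)
    moreover from calculation have "1 < length P"
      using \<open>B \<noteq> {}\<close>
      by (cases P rule: list.exhaust[case_product list.exhaust[of "tl P"]])
        (auto simp: Cons_in_set_comps_iff)
    ultimately show ?thesis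
      by simp
  qed
  then show ?thesis
    by (auto simp: leads_def)
qed

text \<open>
  Concatenation adds lengths, so in \<open>f \<or> g\<close> only the product of the two leading terms has the
  minimal length.
\<close>

lemma leads_vee:
  assumes f: "leads A P f" and g: "leads B Q g"
    and P: "P \<in> set_comps A" and Q: "Q \<in> set_comps B" and AB: "A \<inter> B = {}"
  shows "leads (A \<union> B) (P @ Q) (f \<^bold>\<or> g)"
proof -
  define h :: "nat set list \<Rightarrow> nat set list \<Rightarrow> (nat set list \<Rightarrow>\<^sub>0 'a)" where
    "h = (\<lambda>P Q. if \<Union>(set P) \<inter> \<Union>(set Q) = {} then Poly_Mapping.single (P @ Q) 1 else 0)"
  define f' g' where "f' = f - Poly_Mapping.single P 1" and "g' = g - Poly_Mapping.single Q 1"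
  have f_eq: "f = Poly_Mapping.single P 1 + f'" and g_eq: "g = Poly_Mapping.single Q 1 + g'"
    by (simp_all add: f'_def g'_def)
  have keys_f': "R \<in> set_comps A \<and> length P < length R" if "R \<in> Poly_Mapping.keys f'" for R
    using f that by (auto simp: leads_def f'_def)
  have keys_g': "R \<in> set_comps B \<and> length Q < length R" if "R \<in> Poly_Mapping.keys g'" for R
    using g that by (auto simp: leads_def g'_def)
  have keys_g: "R \<in> set_comps B \<and> length Q \<le> length R" if "R \<in> Poly_Mapping.keys g" for R
  proof -
    have "R = Q \<or> R \<in> Poly_Mapping.keys g'"
      using that by (auto simp: in_keys_iff g_eq Poly_Mapping.lookup_add
          Poly_Mapping.lookup_single when_def)
    then show ?thesis
      using Q keys_g'[of R] by auto
  qed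
  have keys_h: "Poly_Mapping.keys (h R R') \<subseteq> {R @ R'}" for R R'
    by (simp add: h_def)
  have "f \<^bold>\<or> g = lin_ext (h P) g + lin_ext (\<lambda>R. lin_ext (h R) g) f'"
    by (simp add: vee_def bilin_ext_def h_def f_eq lin_ext_add)
  also have "lin_ext (h P) g = Poly_Mapping.single (P @ Q) 1 + lin_ext (h P) g'"
    using P Q AB by (simp add: g_eq lin_ext_add) (simp add: h_def Union_set_comps)
  finally have "(f \<^bold>\<or> g) - Poly_Mapping.single (P @ Q) 1 =
      lin_ext (h P) g' + lin_ext (\<lambda>R. lin_ext (h R) g) f'"
    by simp
  moreover have "Poly_Mapping.keys (lin_ext (h P) g') \<subseteq>
      {R \<in> set_comps (A \<union> B). length (P @ Q) < length R}"
  proof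
    fix R
    assume "R \<in> Poly_Mapping.keys (lin_ext (h P) g')"
    then obtain R' where "R' \<in> Poly_Mapping.keys g'" "R = P @ R'"
      using keys_lin_ext[of "h P" g'] keys_h by blast
    then show "R \<in> {R \<in> set_comps (A \<union> B). length (P @ Q) < length R}"
      using P keys_g' append_in_set_comps[OF _ _ AB] by auto
  qed
  moreover have "Poly_Mapping.keys (lin_ext (\<lambda>R. lin_ext (h R) g) f') \<subseteq>
      {R \<in> set_comps (A \<union> B). length (P @ Q) < length R}"
  proof
    fix R
    assume "R \<in> Poly_Mapping.keys (lin_ext (\<lambda>R. lin_ext (h R) g) f')"
    then obtain R1 where R1: "R1 \<in> Poly_Mapping.keys f'" "R \<in> Poly_Mapping.keys (lin_ext (h R1) g)"
      using keys_lin_ext[of "\<lambda>R. lin_ext (h R) g" f'] by blast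
    then obtain R2 where "R2 \<in> Poly_Mapping.keys g" "R = R1 @ R2"
      using keys_lin_ext[of "h R1" g] keys_h by blast
    then show "R \<in> {R \<in> set_comps (A \<union> B). length (P @ Q) < length R}"
      using keys_f'[OF R1(1)] keys_g[of R2] append_in_set_comps[OF _ _ AB, of R1 R2] by auto
  qed
  ultimately show ?thesis
    unfolding leads_def by (metis (no_types, lifting) Poly_Mapping.keys_add Un_least order_trans)
qed

lemma leads_E_comp:
  assumes E: "\<And>B. finite B \<Longrightarrow> B \<noteq> {} \<Longrightarrow> B \<subseteq> {1..} \<Longrightarrow> primitive_idempotent B (E B)"
    and "finite A" "A \<subseteq> {1..}" "Q \<in> set_comps A"
  shows "leads A Q (E_comp E Q)"
  using assms(2-)
proof (induction Q arbitrary: A)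
  case Nil
  then show ?case
    by (simp add: E_comp_def leads_empty_comp)
next
  case (Cons S Q)
  then have S: "S \<noteq> {}" "S \<subseteq> A" and Q: "Q \<in> set_comps (A - S)"
    by (auto simp: Cons_in_set_comps_iff)
  have fin_S: "finite S"
    using S Cons.prems finite_subset by blast
  have "leads S [S] (E S)"
    using E[of S] S Cons.prems fin_S by (intro leads_primitive_idempotent) auto
  moreover have "leads (A - S) Q (E_comp E Q)"
    using Cons.prems Q by (intro Cons.IH) auto
  moreover have "[S] \<in> set_comps S"
    using S by (simp add: Cons_in_set_comps_iff)
  ultimately have "leads (S \<union> (A - S)) ([S] @ Q) (E S \<^bold>\<or> E_comp E Q)"
    using Q by (intro leads_vee) auto
  moreover have "S \<union> (A - S) = A"
    using S by auto
  ultimately show ?case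
    by (simp add: E_comp_def)
qed

section \<open>Bases\<close>

lemma FPi_eq_span:
  "FPi A = FPi.span ((\<lambda>P. Poly_Mapping.single P 1) ` set_comps A)"
proof
  show "FPi A \<subseteq> FPi.span ((\<lambda>P. Poly_Mapping.single P (1 :: 'f :: field)) ` set_comps A)"
  proof
    fix f :: "nat set list \<Rightarrow>\<^sub>0 'f"
    assume "f \<in> FPi A"
    then have "lin_ext (\<lambda>P. Poly_Mapping.single P 1) f \<in>
        FPi.span ((\<lambda>P. Poly_Mapping.single P 1) ` set_comps A)"
      by (intro lin_ext_in_span FPi.span_base) (auto simp: FPi_def)
    then show "f \<in> FPi.span ((\<lambda>P. Poly_Mapping.single P 1) ` set_comps A)"
      by (simp only: lin_ext_singles)
  qed
  have "FPi.subspace (FPi A)"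
    unfolding FPi.subspace_def FPi_def
    using Poly_Mapping.keys_add keys_smul by fastforce
  then show "FPi.span ((\<lambda>P. Poly_Mapping.single P 1) ` set_comps A) \<subseteq> FPi A"
    by (intro FPi.span_minimal) (auto simp: FPi_def)
qed

lemma independent_singles: "FPi.independent ((\<lambda>P. Poly_Mapping.single P (1 :: 'f :: field)) ` K)"
proof
  let ?s = "\<lambda>P. Poly_Mapping.single P (1 :: 'f)"
  assume "FPi.dependent (?s ` K)"
  then obtain P where P: "?s P \<in> FPi.span (?s ` K - {?s P})"
    by (auto simp: FPi.dependent_def)
  have "FPi.subspace {f :: 'a \<Rightarrow>\<^sub>0 'f. Poly_Mapping.lookup f P = 0}"
    by (auto simp: FPi.subspace_def Poly_Mapping.lookup_add lookup_smul)
  then have "FPi.span (?s ` K - {?s P}) \<subseteq> {f. Poly_Mapping.lookup f P = 0}"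
    by (intro FPi.span_minimal) (auto simp: Poly_Mapping.lookup_single when_def)
  with P show False
    by auto
qed

text \<open>
  A linear dependence would allow one to drop a vector from \<open>T\<close> and still span \<open>S\<close>,
  contradicting the Steinitz exchange bound.
\<close>

lemma (in vector_space) independent_if_spans_large_independent:
  assumes "finite T" "independent S" "S \<subseteq> span T" "card T \<le> card S"
  shows "independent T"
proof
  assume "dependent T"
  then obtain x where x: "x \<in> T" "x \<in> span (T - {x})"
    by (auto simp: dependent_def)
  then have "S \<subseteq> span (T - {x})"
    using assms(3) span_redundant[of x "T - {x}"] by (simp add: insert_absorb)
  then have "card S \<le> card (T - {x})"
    using independent_span_bound[of "T - {x}" S] assms by auto
  also have "\<dots> < card T"
    using x assms(1) by (intro card_Diff1_less)
  finally show False
    using assms(4) by simp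
qed

theorem proposition5p1:
  fixes E :: "nat set \<Rightarrow> (nat set list \<Rightarrow>\<^sub>0 'f::field)"
    and A :: "nat set"
  assumes "\<And>B. finite B \<Longrightarrow> B \<noteq> {} \<Longrightarrow> B \<subseteq> {1..} \<Longrightarrow> primitive_idempotent B (E B)"
    and "finite A" and "A \<subseteq> {1..}"
  shows "FPi.independent {E_comp E Q |Q. Q \<in> set_comps A}
    \<and> FPi.span {E_comp E Q |Q. Q \<in> set_comps A} = FPi A"
proof -
  let ?s = "\<lambda>P. Poly_Mapping.single P (1 :: 'f)"
  define T where "T = E_comp E ` set_comps A"
  have T_eq: "{E_comp E Q |Q. Q \<in> set_comps A} = T"
    by (auto simp: T_def)
  have leads: "leads A Q (E_comp E Q)" if "Q \<in> set_comps A" for Q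
    using leads_E_comp[OF assms that] .
  have fin: "finite (set_comps A)"
    using assms by (simp add: finite_set_comps)
  obtain n where n: "length P \<le> n" if "P \<in> set_comps A" for P
    using finite_nat_set_iff_bounded_le[of "length ` set_comps A"] fin by auto
  have single_in_span: "?s P \<in> FPi.span T" if "P \<in> set_comps A" for P
    using that
  proof (induction "n - length P" arbitrary: P rule: less_induct)
    case less
    define r where "r = E_comp E P - ?s P"
    have "lin_ext ?s r \<in> FPi.span T"
    proof (rule lin_ext_in_span)
      fix Q
      assume "Q \<in> Poly_Mapping.keys r"
      then have "Q \<in> set_comps A" "length P < length Q"
        using leads[OF less.prems] by (auto simp: leads_def r_def)
      moreover from this have "n - length Q < n - length P"
        using n[of Q] by linarith
      ultimately show "?s Q \<in> FPi.span T"
        by (intro less.hyps)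
    qed
    then have "r \<in> FPi.span T"
      by (simp only: lin_ext_singles)
    moreover have "E_comp E P \<in> FPi.span T"
      using less.prems by (intro FPi.span_base) (simp add: T_def)
    ultimately have "E_comp E P - r \<in> FPi.span T"
      by (intro FPi.span_diff)
    then show ?case
      by (simp add: r_def)
  qed
  have "T \<subseteq> FPi A"
  proof
    fix f
    assume "f \<in> T"
    then obtain Q where Q: "Q \<in> set_comps A" "f = E_comp E Q"
      by (auto simp: T_def)
    have "Poly_Mapping.keys f \<subseteq>
        insert Q (Poly_Mapping.keys (f - ?s Q))"
      by (auto simp: in_keys_iff Poly_Mapping.lookup_minus Poly_Mapping.lookup_single when_def
          split: if_splits)
    then show "f \<in> FPi A"
      using leads[OF Q(1)] Q by (auto simp: leads_def FPi_def)
  qed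
  then have "FPi.span T = FPi A"
    using single_in_span unfolding FPi_eq_span FPi.span_eq by auto
  moreover have "FPi.independent T"
  proof (rule FPi.independent_if_spans_large_independent)
    show "FPi.independent (?s ` set_comps A)"
      by (rule independent_singles)
    have "inj_on ?s (set_comps A)"
      by (auto intro!: inj_onI dest!: arg_cong[where f = Poly_Mapping.keys])
    then show "card T \<le> card (?s ` set_comps A)"
      using fin by (simp add: T_def card_image card_image_le)
  qed (use fin single_in_span in \<open>auto simp: T_def\<close>)
  ultimately show ?thesis
    by (simp only: T_eq simp_thms)
qed

end
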